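(* Let $\mathcal{H}$ be a complex Hilbert space and let $T\in\mathcal{B}(\mathcal{H})$. Then $$\frac{1}{2}\sup_{\theta\in\mathbb{R}}\left\{w^2\left(e^{\mathrm{i}\theta}T+T^*T\right)+c^2\left(e^{\mathrm{i}\theta}T-T^*T\right)\right\}\leq dw^2(T)\leq \frac{1}{2}\left\{w^2(T+T^*T)+w^2(T-T^*T)\right\}.$$
   Context: $\mathcal{B}(\mathcal{H})$ is the algebra of bounded linear operators on the complex Hilbert space $\mathcal{H}$. For $T\in\mathcal{B}(\mathcal{H})$: the numerical radius is $w(T)=\sup\{|\langle Tx,x\rangle|: \|x\|=1\}$; the Crawford number is $c(T)=\inf\{|\langle Tx,x\rangle|: \|x\|=1\}$; the Davis-Wielandt radius is $dw(T)=\sup\{\sqrt{|\langle Tx,x\rangle|^2+\|Tx\|^4}: \|x\|=1\}$, with $x$ ranging over unit vectors of $\mathcal{H}$. Powers such as $dw^2(T)$ mean $(dw(T))^2$, and similarly for $w^2$, $c^2$. *)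

theory Defs
  imports "HOL-Analysis.Analysis"
begin

class complex_vector = real_vector +
  fixes scaleC :: "complex \<Rightarrow> 'a \<Rightarrow> 'a"  (infixr "*\<^sub>C" 75)
  assumes scaleC_add_right: "a *\<^sub>C (x + y) = a *\<^sub>C x + a *\<^sub>C y"
    and scaleC_add_left: "(a + b) *\<^sub>C x = a *\<^sub>C x + b *\<^sub>C x"
    and scaleC_scaleC: "a *\<^sub>C b *\<^sub>C x = (a * b) *\<^sub>C x"
    and scaleC_of_real: "complex_of_real r *\<^sub>C x = r *\<^sub>R x"

text \<open>The inner product is linear in its first argument and conjugate-linear in its second.\<close>

class complex_inner = complex_vector + real_normed_vector +
  fixes cinner :: "'a \<Rightarrow> 'a \<Rightarrow> complex"
  assumes cinner_commute: "cinner x y = cnj (cinner y x)"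
    and cinner_add_left: "cinner (x + y) z = cinner x z + cinner y z"
    and cinner_scaleC_left: "cinner (a *\<^sub>C x) y = a * cinner x y"
    and cinner_self_nonneg: "0 \<le> Re (cinner x x)"
    and cinner_self_eq_zero: "cinner x x = 0 \<longleftrightarrow> x = 0"
    and norm_eq_sqrt_cinner: "norm x = sqrt (Re (cinner x x))"

class chilbert_space = complex_inner + complete_space

instantiation complex :: chilbert_space
begin

definition scaleC_complex :: "complex \<Rightarrow> complex \<Rightarrow> complex"
  where "scaleC_complex a x = a * x"

definition cinner_complex :: "complex \<Rightarrow> complex \<Rightarrow> complex"
  where "cinner_complex x y = x * cnj y"

instance
proof
  fix a b x y z :: complex and r :: real
  show "a *\<^sub>C (x + y) = a *\<^sub>C x + a *\<^sub>C y" "(a + b) *\<^sub>C x = a *\<^sub>C x + b *\<^sub>C x"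
    "a *\<^sub>C b *\<^sub>C x = (a * b) *\<^sub>C x"
    by (simp_all add: scaleC_complex_def algebra_simps)
  show "complex_of_real r *\<^sub>C x = r *\<^sub>R x"
    by (simp add: scaleC_complex_def scaleR_conv_of_real)
  show "cinner x y = cnj (cinner y x)" "cinner (x + y) z = cinner x z + cinner y z"
    "cinner (a *\<^sub>C x) y = a * cinner x y" "cinner x x = 0 \<longleftrightarrow> x = 0"
    by (simp_all add: scaleC_complex_def cinner_complex_def algebra_simps)
  show "0 \<le> Re (cinner x x)" "norm x = sqrt (Re (cinner x x))"
    by (simp_all add: cinner_complex_def complex_mult_cnj cmod_def)
qed

end

definition bounded_clinear :: "('a::complex_inner \<Rightarrow> 'a) \<Rightarrow> bool"
  where "bounded_clinear T \<longleftrightarrow> bounded_linear T \<and> (\<forall>a x. T (a *\<^sub>C x) = a *\<^sub>C T x)"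

text \<open>On a Hilbert space the description below is met by exactly one operator whenever
  \<^term>\<open>T\<close> is bounded and complex-linear (Riesz representation); otherwise the value is
  unspecified.\<close>

definition cadjoint :: "('a::chilbert_space \<Rightarrow> 'a) \<Rightarrow> ('a \<Rightarrow> 'a)"
  where "cadjoint T = (THE S. bounded_clinear S \<and> (\<forall>x y. cinner (T x) y = cinner x (S y)))"

text \<open>On the zero space there are no unit vectors, and the three quantities below take
  the library's values for \<^term>\<open>Sup {} :: real\<close> and \<^term>\<open>Inf {} :: real\<close>.\<close>

definition numerical_radius :: "('a::complex_inner \<Rightarrow> 'a) \<Rightarrow> real"
  where "numerical_radius T = Sup {cmod (cinner (T x) x) | x. norm x = 1}"

definition crawford_number :: "('a::complex_inner \<Rightarrow> 'a) \<Rightarrow> real"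
  where "crawford_number T = Inf {cmod (cinner (T x) x) | x. norm x = 1}"

definition davis_wielandt_radius :: "('a::complex_inner \<Rightarrow> 'a) \<Rightarrow> real"
  where "davis_wielandt_radius T =
    Sup {sqrt ((cmod (cinner (T x) x))\<^sup>2 + norm (T x) ^ 4) | x. norm x = 1}"

end

theory Submission
  imports Defs
begin

text \<open>For a unit vector \<open>x\<close> put \<open>a = \<langle>Tx, x\<rangle>\<close> and \<open>b = \<langle>T\<^sup>*Tx, x\<rangle> = \<parallel>Tx\<parallel>\<^sup>2\<close>. The parallelogram law in
  the complex plane gives \<open>2 (\<bar>a\<bar>\<^sup>2 + b\<^sup>2) = \<bar>u a + b\<bar>\<^sup>2 + \<bar>u a - b\<bar>\<^sup>2\<close> for every unimodular \<open>u\<close>. Taking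
  \<open>u = 1\<close> and bounding both terms on the right from above yields the upper bound; bounding the
  second term from below by the Crawford number yields the lower one.\<close>

section \<open>Complex inner products\<close>

lemma cinner_add_right: "cinner x (y + z) = cinner x y + cinner x z"
  for x y z :: "'a::complex_inner"
  by (metis cinner_add_left cinner_commute complex_cnj_add)

lemma cinner_scaleC_right: "cinner x (a *\<^sub>C y) = cnj a * cinner x y"
  for x y :: "'a::complex_inner"
  by (metis cinner_scaleC_left cinner_commute complex_cnj_mult)

lemma cinner_scaleR_left: "cinner (r *\<^sub>R x) y = of_real r * cinner x y"
  for x y :: "'a::complex_inner"
  by (metis cinner_scaleC_left scaleC_of_real)

lemma cinner_scaleR_right: "cinner x (r *\<^sub>R y) = of_real r * cinner x y"
  for x y :: "'a::complex_inner"
  by (metis cinner_scaleC_right scaleC_of_real complex_cnj_complex_of_real)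

lemma cinner_minus_left: "cinner (- x) y = - cinner x y"
  for x y :: "'a::complex_inner"
  using cinner_scaleR_left[of "-1" x y] by simp

lemma cinner_minus_right: "cinner x (- y) = - cinner x y"
  for x y :: "'a::complex_inner"
  using cinner_scaleR_right[of x "-1" y] by simp

lemma cinner_diff_left: "cinner (x - y) z = cinner x z - cinner y z"
  for x y z :: "'a::complex_inner"
  using cinner_add_left[of x "- y" z] by (simp add: cinner_minus_left)

lemma cinner_diff_right: "cinner x (y - z) = cinner x y - cinner x z"
  for x y z :: "'a::complex_inner"
  using cinner_add_right[of x y "- z"] by (simp add: cinner_minus_right)

lemma power2_norm_eq_cinner: "(norm x)\<^sup>2 = Re (cinner x x)"
  for x :: "'a::complex_inner"
  by (simp add: norm_eq_sqrt_cinner cinner_self_nonneg)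

lemma cinner_self: "cinner x x = of_real ((norm x)\<^sup>2)"
  for x :: "'a::complex_inner"
  using cinner_commute[of x x]
  by (simp add: complex_eq_iff power2_norm_eq_cinner)

lemma power2_norm_add: "(norm (x + y))\<^sup>2 = (norm x)\<^sup>2 + 2 * Re (cinner x y) + (norm y)\<^sup>2"
  for x y :: "'a::complex_inner"
  using arg_cong[OF cinner_commute[of y x], of Re]
  by (simp add: power2_norm_eq_cinner cinner_add_left cinner_add_right)

lemma parallelogram_law: "(norm (x + y))\<^sup>2 + (norm (x - y))\<^sup>2 = 2 * (norm x)\<^sup>2 + 2 * (norm y)\<^sup>2"
  for x y :: "'a::complex_inner"
  using power2_norm_add[of x y] power2_norm_add[of x "- y"]
  by (simp add: cinner_minus_right)

lemma cinner_ext: "x = y" if "\<And>z. cinner z x = cinner z y"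
  for x y :: "'a::complex_inner"
proof -
  have "cinner (x - y) (x - y) = 0"
    by (simp add: cinner_diff_right that)
  then show ?thesis by (simp add: cinner_self_eq_zero)
qed

lemma norm_scaleC: "norm (a *\<^sub>C x) = cmod a * norm x"
  for x :: "'a::complex_inner"
proof -
  have "(norm (a *\<^sub>C x))\<^sup>2 = Re ((a * cnj a) * cinner x x)"
    unfolding power2_norm_eq_cinner cinner_scaleC_left cinner_scaleC_right
    by (simp only: mult_ac)
  also have "\<dots> = (cmod a * norm x)\<^sup>2"
    unfolding cinner_self complex_norm_square[symmetric] of_real_mult[symmetric] Re_complex_of_real
    by (simp only: power_mult_distrib)
  finally show ?thesis by (simp add: power2_eq_iff_nonneg)
qed

text \<open>The triangle inequality already belongs to the class via
  \<open>real_normed_vector\<close>, so the usual order is reversed: squaring it and cancelling the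
  two squares leaves this bound.\<close>

lemma Re_cinner_le: "Re (cinner x y) \<le> norm x * norm y"
  for x y :: "'a::complex_inner"
proof -
  have "(norm (x + y))\<^sup>2 \<le> (norm x + norm y)\<^sup>2"
    by (simp add: norm_triangle_ineq)
  then show ?thesis by (simp add: power2_norm_add power2_sum)
qed

text \<open>Cauchy-Schwarz. Multiplying \<open>x\<close> by a unimodular \<open>u\<close> keeps its
  norm and rotates the inner product onto the nonnegative real axis, where its modulus is its real
  part.\<close>

lemma norm_cinner_le: "cmod (cinner x y) \<le> norm x * norm y"
  for x y :: "'a::complex_inner"
proof (cases "cinner x y = 0")
  case False
  define u where "u = cnj (cinner x y) / cmod (cinner x y)"
  have u: "cmod u = 1" using False by (simp add: u_def norm_divide)
  have "cnj (cinner x y) * cinner x y = of_real (cmod (cinner x y)) * of_real (cmod (cinner x y))"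
    using complex_norm_square[of "cinner x y"] by (simp add: power2_eq_square mult.commute)
  then have "u * cinner x y = cmod (cinner x y)"
    using False by (simp add: u_def)
  then have "cmod (cinner x y) = Re (cinner (u *\<^sub>C x) y)"
    by (simp add: cinner_scaleC_left)
  also have "\<dots> \<le> norm x * norm y"
    using Re_cinner_le[of "u *\<^sub>C x" y] by (simp add: norm_scaleC u)
  finally show ?thesis .
qed simp

section \<open>Riesz representation and the adjoint\<close>

text \<open>The representing vector minimises \<open>\<parallel>y\<parallel>\<^sup>2 - 2 g y\<close>; by the parallelogram law a minimising
  sequence is Cauchy.\<close>

lemma riesz_representation:
  fixes g :: "'a::chilbert_space \<Rightarrow> real"
  assumes "bounded_linear g"
  obtains u where "\<And>x. g x = Re (cinner x u)"
proof -
  interpret g: bounded_linear g by fact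
  define J where "J y = (norm y)\<^sup>2 - 2 * g y" for y
  obtain K where K: "\<And>x. norm (g x) \<le> norm x * K" using g.bounded by blast
  \<comment> \<open>Since \<open>g y\<close> is at most \<open>K * norm y\<close>, completing the
    square gives \<open>J y >= (norm y - K)^2 - K^2\<close>.\<close>
  have J_ge: "- K\<^sup>2 \<le> J y" for y
  proof -
    have "0 \<le> (norm y - K)\<^sup>2" by simp
    then show ?thesis using K[of y] by (simp add: J_def power2_diff)
  qed
  define m where "m = Inf (range J)"
  have bdd: "bdd_below (range J)" using J_ge by (intro bdd_belowI2)
  have m_le: "m \<le> J y" for y
    unfolding m_def using bdd by (auto intro: cInf_lower)
  have "\<exists>y. J y < m + inverse (Suc n)" for n
    using cInf_lessD[of "range J" "m + inverse (Suc n)"] by (auto simp: m_def)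
  then obtain X where X: "\<And>n. J (X n) < m + inverse (Suc n)" by metis
  \<comment> \<open>The midpoint of \<open>a\<close> and \<open>b\<close> also has \<open>J\<close>
    at least \<open>m\<close>; by the parallelogram law the squared distance is
    \<open>2 J a + 2 J b\<close> minus four times \<open>J\<close> at the midpoint.\<close>
  have dist: "(norm (a - b))\<^sup>2 \<le> 2 * (J a - m) + 2 * (J b - m)" for a b
  proof -
    have "4 * J ((1 / 2) *\<^sub>R (a + b)) = (norm (a + b))\<^sup>2 - 4 * g a - 4 * g b"
      by (simp add: J_def g.scaleR g.add power_mult_distrib power_divide algebra_simps
        del: scaleR_add_right flip: scaleR_right_distrib)
    then show ?thesis
      using m_le[of "(1 / 2) *\<^sub>R (a + b)"] parallelogram_law[of a b] by (simp add: J_def)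
  qed
  have "Cauchy X"
  proof (rule metric_CauchyI)
    fix e :: real assume "0 < e"
    \<comment> \<open>\<open>dist\<close> doubles each of the two excesses over \<open>m\<close>, so
      a quarter of the square of \<open>e\<close> suffices for each.\<close>
    then obtain N where N: "inverse (real (Suc N)) < e\<^sup>2 / 4"
      using reals_Archimedean[of "e\<^sup>2 / 4"] by auto
    have small: "J (X n) - m < e\<^sup>2 / 4" if "N \<le> n" for n
    proof -
      have "inverse (real (Suc n)) \<le> inverse (real (Suc N))" using that by (simp add: le_imp_inverse_le)
      then show ?thesis using X[of n] N by linarith
    qed
    have "dist (X i) (X j) < e" if "N \<le> i" "N \<le> j" for i j
    proof -
      have "(norm (X i - X j))\<^sup>2 < e\<^sup>2"
        using dist[of "X i" "X j"] small[OF that(1)] small[OF that(2)] by simp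
      then show ?thesis using \<open>0 < e\<close> by (simp add: dist_norm power2_less_imp_less)
    qed
    then show "\<exists>N. \<forall>i\<ge>N. \<forall>j\<ge>N. dist (X i) (X j) < e" by blast
  qed
  then obtain u where u: "X \<longlonglongrightarrow> u" using Cauchy_convergent convergent_def by blast
  have "(\<lambda>n. J (X n)) \<longlonglongrightarrow> J u"
    unfolding J_def by (intro tendsto_intros g.tendsto u)
  moreover have "(\<lambda>n. m + inverse (real (Suc n))) \<longlonglongrightarrow> m + 0"
    by (intro tendsto_intros LIMSEQ_inverse_real_of_nat)
  ultimately have "J u \<le> m + 0"
    by (rule LIMSEQ_le) (use X less_imp_le in blast)
  then have u_min: "J u \<le> J y" for y using m_le[of y] by linarith
  have le: "g z \<le> Re (cinner z u)" for z
  proof (rule ccontr)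
    define d where "d = g z - Re (cinner z u)"
    assume "\<not> g z \<le> Re (cinner z u)"
    then have d: "0 < d" by (simp add: d_def)
    \<comment> \<open>A move from \<open>u\<close> by \<open>t\<close> along \<open>z\<close>
      changes \<open>J\<close> by \<open>t^2 * norm z ^ 2 - 2 * t * d\<close>. With this
      \<open>t\<close> the change is \<open>t * (- d - t) < 0\<close>, contradicting minimality; the
      \<open>+ 1\<close> covers \<open>z = 0\<close>.\<close>
    define t where "t = d / ((norm z)\<^sup>2 + 1)"
    have t: "0 < t" using d by (simp add: t_def add_nonneg_pos)
    have "t * ((norm z)\<^sup>2 + 1) = d"
      unfolding t_def using sum_power2_gt_zero_iff[of "norm z" 1] by (simp add: field_simps)
    moreover have "J (t *\<^sub>R z + u) = J u + t * (t * (norm z)\<^sup>2 - 2 * d)"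
      unfolding J_def d_def power2_norm_add g.add g.scaleR cinner_scaleR_left
      by (simp add: power2_eq_square algebra_simps)
    moreover from calculation have "t * (norm z)\<^sup>2 = d - t" by (simp add: algebra_simps)
    ultimately have "0 \<le> t * (- d - t)" using u_min[of "t *\<^sub>R z + u"] by simp
    moreover have "t * (- d - t) < 0" using t d by (intro mult_pos_neg) auto
    ultimately show False by simp
  qed
  \<comment> \<open>Both sides are odd in \<open>x\<close>, so the inequality at \<open>- x\<close>
    is the reverse one.\<close>
  have "g x = Re (cinner x u)" for x
    using le[of x] le[of "- x"] by (simp add: g.neg cinner_minus_left)
  then show ?thesis using that by blast
qed

text \<open>Justifies the definite description in \<open>cadjoint\<close>. For fixed
  \<open>y\<close>, the value \<open>S y\<close> is the Riesz vector of the real functional sending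
  \<open>x\<close> to \<open>Re (cinner (T x) y)\<close>; linearity of \<open>S\<close> and
  uniqueness follow by testing against all vectors.\<close>

lemma ex1_adjoint:
  fixes T :: "'a::chilbert_space \<Rightarrow> 'a"
  assumes "bounded_clinear T"
  shows "\<exists>!S. bounded_clinear S \<and> (\<forall>x y. cinner (T x) y = cinner x (S y))"
proof -
  interpret T: bounded_linear T using assms by (simp add: bounded_clinear_def)
  have T_scaleC: "T (a *\<^sub>C x) = a *\<^sub>C T x" for a x
    using assms by (simp add: bounded_clinear_def)
  obtain K where K: "0 \<le> K" "\<And>x. norm (T x) \<le> norm x * K" using T.nonneg_bounded by blast
  have "\<exists>u. \<forall>x. cinner (T x) y = cinner x u" for y
  proof -
    have "bounded_linear (\<lambda>x. Re (cinner (T x) y))"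
    proof (rule bounded_linear_intro[where K = "K * norm y"])
      fix x
      have "norm (Re (cinner (T x) y)) \<le> norm (T x) * norm y"
        using abs_Re_le_cmod norm_cinner_le order_trans by (metis real_norm_def)
      also have "\<dots> \<le> norm x * K * norm y" by (intro mult_right_mono K) simp
      finally show "norm (Re (cinner (T x) y)) \<le> norm x * (K * norm y)" by (simp add: mult.assoc)
    qed (simp_all add: T.add T.scaleR cinner_add_left cinner_scaleR_left)
    then obtain u where u: "\<And>x. Re (cinner (T x) y) = Re (cinner x u)"
      by (rule riesz_representation) auto
    \<comment> \<open>Riesz only matches real parts; replacing \<open>x\<close> by \<open>i\<close>
      times \<open>x\<close> turns them into negated imaginary parts.\<close>
    have "cinner (T x) y = cinner x u" for x
      using u[of x] u[of "\<i> *\<^sub>C x"] by (simp add: T_scaleC cinner_scaleC_left complex_eq_iff)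
    then show ?thesis by blast
  qed
  then obtain S where S: "\<And>x y. cinner (T x) y = cinner x (S y)" by metis
  have S_scaleC: "S (a *\<^sub>C y) = a *\<^sub>C S y" for a y
    by (rule cinner_ext) (simp add: cinner_scaleC_right flip: S)
  have "bounded_linear S"
  proof (rule bounded_linear_intro[where K = K])
    show "S (x + y) = S x + S y" for x y
      by (rule cinner_ext) (simp add: cinner_add_right flip: S)
    show "S (r *\<^sub>R x) = r *\<^sub>R S x" for r x
      by (metis S_scaleC scaleC_of_real)
    \<comment> \<open>The adjoint identity at \<open>x = S y\<close> bounds the square of
      \<open>norm (S y)\<close> by \<open>norm (S y) * K * norm y\<close>, and a nonzero factor
      \<open>norm (S y)\<close> cancels.\<close>
    show "norm (S y) \<le> norm y * K" for y
    proof (cases "S y = 0")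
      case False
      have "norm (S y) * norm (S y) = Re (cinner (T (S y)) y)"
        by (simp add: S flip: power2_norm_eq_cinner power2_eq_square)
      also have "\<dots> \<le> norm (T (S y)) * norm y" by (rule Re_cinner_le)
      also have "\<dots> \<le> norm (S y) * K * norm y" by (intro mult_right_mono K) simp
      also have "\<dots> = norm (S y) * (norm y * K)" by simp
      finally show ?thesis using False by simp
    qed (simp add: K(1))
  qed
  then have "bounded_clinear S" by (simp add: bounded_clinear_def S_scaleC)
  moreover have "S' = S" if "\<forall>x y. cinner (T x) y = cinner x (S' y)" for S'
    by (rule ext, rule cinner_ext) (simp add: that[rule_format, symmetric] S)
  ultimately show ?thesis using S by blast
qed

lemma cinner_cadjoint_right:
  fixes T :: "'a::chilbert_space \<Rightarrow> 'a"
  assumes "bounded_clinear T"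
  shows "cinner x (cadjoint T y) = cinner (T x) y"
  using theI'[OF ex1_adjoint[OF assms], folded cadjoint_def] by simp

lemma cinner_cadjoint_self:
  fixes T :: "'a::chilbert_space \<Rightarrow> 'a"
  assumes "bounded_clinear T"
  shows "cinner (cadjoint T (T x)) x = of_real ((norm (T x))\<^sup>2)"
proof -
  have "cinner (cadjoint T (T x)) x = cnj (cinner (T x) (T x))"
    by (metis assms cinner_cadjoint_right cinner_commute)
  then show ?thesis by (simp add: cinner_self)
qed

section \<open>The Davis--Wielandt radius\<close>

lemma cmod_parallelogram:
  assumes "cmod u = 1"
  shows "(cmod (u * a + b))\<^sup>2 + (cmod (u * a - b))\<^sup>2 = 2 * ((cmod a)\<^sup>2 + (cmod b)\<^sup>2)"
proof -
  have "(cmod (z + b))\<^sup>2 + (cmod (z - b))\<^sup>2 = 2 * ((cmod z)\<^sup>2 + (cmod b)\<^sup>2)" for z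
    by (simp add: cmod_power2 power2_sum power2_diff)
  from this[of "u * a"] show ?thesis using assms by (simp add: norm_mult)
qed

text \<open>A real \<open>Sup\<close> is controlled only for a nonempty set that is bounded above,
  hence the two premises; any one member of the set is then a nonnegative lower bound for the
  supremum.\<close>

lemma numerical_radius_nonneg:
  "0 \<le> numerical_radius A" if "\<exists>x::'a. norm x = 1" "bdd_above {cmod (cinner (A x) x) | x. norm x = 1}"
  for A :: "'a::complex_inner \<Rightarrow> 'a"
proof -
  from that(1) obtain x :: 'a where "norm x = 1" by blast
  then have "cmod (cinner (A x) x) \<le> numerical_radius A"
    unfolding numerical_radius_def by (intro cSup_upper that(2)) blast
  then show ?thesis using norm_ge_zero order_trans by blast
qed

text \<open>On the zero space \<^term>\<open>Inf {} = - (Sup {} :: real)\<close>, so after squaring all three quantities agree and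
  both inequalities become equalities.\<close>

lemma trivial_space_radii:
  fixes A B :: "'a::complex_inner \<Rightarrow> 'a"
  assumes "\<nexists>x::'a. norm x = 1"
  shows "numerical_radius A = davis_wielandt_radius B" "crawford_number A = - davis_wielandt_radius B"
  using assms by (simp_all add: numerical_radius_def crawford_number_def davis_wielandt_radius_def Inf_real_def)

lemma davis_wielandt_bounds:
  fixes T :: "'a::chilbert_space \<Rightarrow> 'a"
  assumes T: "bounded_clinear T" and ex: "\<exists>x::'a. norm x = 1" and u: "cmod u = 1"
  defines "P \<equiv> \<lambda>x. u *\<^sub>C T x + cadjoint T (T x)"
    and "M \<equiv> \<lambda>x. u *\<^sub>C T x - cadjoint T (T x)"
  shows "(numerical_radius P)\<^sup>2 + (crawford_number M)\<^sup>2 \<le> 2 * (davis_wielandt_radius T)\<^sup>2"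
    and "2 * (davis_wielandt_radius T)\<^sup>2 \<le> (numerical_radius P)\<^sup>2 + (numerical_radius M)\<^sup>2"
proof -
  let ?p = "\<lambda>x. cmod (cinner (P x) x)" and ?m = "\<lambda>x. cmod (cinner (M x) x)"
  let ?d = "\<lambda>x. sqrt ((cmod (cinner (T x) x))\<^sup>2 + norm (T x) ^ 4)"
  interpret T: bounded_linear T using T by (simp add: bounded_clinear_def)
  have P: "cinner (P x) x = u * cinner (T x) x + of_real ((norm (T x))\<^sup>2)" for x
    by (simp add: P_def cinner_add_left cinner_scaleC_left cinner_cadjoint_self[OF T])
  have M: "cinner (M x) x = u * cinner (T x) x - of_real ((norm (T x))\<^sup>2)" for x
    by (simp add: M_def cinner_diff_left cinner_scaleC_left cinner_cadjoint_self[OF T])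
  \<comment> \<open>Here \<open>b\<close> is the square of \<open>norm (T x)\<close>, so its squared
    modulus is the fourth power inside \<open>?d\<close>.\<close>
  have sum: "(?p x)\<^sup>2 + (?m x)\<^sup>2 = 2 * (?d x)\<^sup>2" for x
    unfolding P M cmod_parallelogram[OF u] by (simp add: norm_power flip: power_mult)
  obtain K where K: "\<And>x. norm (T x) \<le> norm x * K" "0 \<le> K" using T.nonneg_bounded by blast
  have d_le: "?d x \<le> sqrt (K\<^sup>2 + K ^ 4)" if "norm x = 1" for x
  proof -
    have "norm (T x) \<le> K" using K(1)[of x] that by simp
    moreover from this have "cmod (cinner (T x) x) \<le> K" using norm_cinner_le[of "T x" x] that by simp
    ultimately show ?thesis by (intro real_sqrt_le_mono add_mono power_mono) auto
  qed
  have bdd_d: "bdd_above {?d x | x. norm x = 1}"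
    by (rule bdd_aboveI[where M = "sqrt (K\<^sup>2 + K ^ 4)"]) (use d_le in blast)
  \<comment> \<open>By \<open>sum\<close>, each of the two squares is at most twice the square of
    \<open>?d x\<close>; this gives the boundedness that \<open>cSup_upper\<close> requires.\<close>
  have pm_le: "?p x \<le> sqrt (2 * (K\<^sup>2 + K ^ 4))" "?m x \<le> sqrt (2 * (K\<^sup>2 + K ^ 4))" if "norm x = 1" for x
  proof -
    have "(?d x)\<^sup>2 \<le> K\<^sup>2 + K ^ 4" using d_le[OF that] by simp
    then show "?p x \<le> sqrt (2 * (K\<^sup>2 + K ^ 4))"
      by (intro real_le_rsqrt) (use sum[of x] zero_le_power2[of "?m x"] in argo)
    from \<open>(?d x)\<^sup>2 \<le> K\<^sup>2 + K ^ 4\<close> show "?m x \<le> sqrt (2 * (K\<^sup>2 + K ^ 4))"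
      by (intro real_le_rsqrt) (use sum[of x] zero_le_power2[of "?p x"] in argo)
  qed
  have bdd_p: "bdd_above {?p x | x. norm x = 1}" and bdd_m: "bdd_above {?m x | x. norm x = 1}"
    by (rule bdd_aboveI[where M = "sqrt (2 * (K\<^sup>2 + K ^ 4))"], use pm_le in blast)+
  have p_up: "?p x \<le> numerical_radius P" and m_up: "?m x \<le> numerical_radius M"
    and m_low: "crawford_number M \<le> ?m x" and d_up: "?d x \<le> davis_wielandt_radius T" if "norm x = 1" for x
    unfolding numerical_radius_def crawford_number_def davis_wielandt_radius_def
    using that by (auto intro!: cSup_upper bdd_p bdd_m bdd_d cInf_lower bdd_belowI[of _ 0])
  \<comment> \<open>Nonnegativity lets the lower bound \<open>m_low\<close> be squared.\<close>
  have c0: "0 \<le> crawford_number M"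
    unfolding crawford_number_def using ex by (intro cInf_greatest) auto
  obtain x0 :: 'a where x0: "norm x0 = 1" using ex by blast
  have d0: "0 \<le> davis_wielandt_radius T" by (rule order_trans[OF _ d_up[OF x0]]) simp
  \<comment> \<open>Solve \<open>sum\<close> for the square of \<open>?p x\<close>, then bound
    \<open>?d x\<close> above by its supremum and \<open>?m x\<close> below by its infimum. The
    square root puts the bound on \<open>?p x\<close> itself, so that it passes to the
    supremum.\<close>
  have "?p x \<le> sqrt (2 * (davis_wielandt_radius T)\<^sup>2 - (crawford_number M)\<^sup>2)" if "norm x = 1" for x
  proof (rule real_le_rsqrt)
    have "(?d x)\<^sup>2 \<le> (davis_wielandt_radius T)\<^sup>2" using d_up[OF that] by (intro power_mono) auto
    moreover have "(crawford_number M)\<^sup>2 \<le> (?m x)\<^sup>2" using m_low[OF that] c0 by (rule power_mono)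
    ultimately show "(?p x)\<^sup>2 \<le> 2 * (davis_wielandt_radius T)\<^sup>2 - (crawford_number M)\<^sup>2"
      using sum[of x] by linarith
  qed
  then have "numerical_radius P \<le> sqrt (2 * (davis_wielandt_radius T)\<^sup>2 - (crawford_number M)\<^sup>2)"
    unfolding numerical_radius_def using ex by (intro cSup_least) auto
  moreover have "0 \<le> numerical_radius P" by (rule numerical_radius_nonneg[OF ex bdd_p])
  \<comment> \<open>\<open>sqrt\<close> is negative at negative arguments, so a root lying above the
    nonnegative \<open>numerical_radius P\<close> has a nonnegative radicand, and squaring recovers
    that radicand.\<close>
  ultimately show "(numerical_radius P)\<^sup>2 + (crawford_number M)\<^sup>2 \<le> 2 * (davis_wielandt_radius T)\<^sup>2"
    using real_sqrt_ge_0_iff[of "2 * (davis_wielandt_radius T)\<^sup>2 - (crawford_number M)\<^sup>2"]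
      power_mono[of "numerical_radius P" _ 2] by fastforce
  have "?d x \<le> sqrt (((numerical_radius P)\<^sup>2 + (numerical_radius M)\<^sup>2) / 2)" if "norm x = 1" for x
  proof (rule real_le_rsqrt)
    have "(?p x)\<^sup>2 \<le> (numerical_radius P)\<^sup>2" "(?m x)\<^sup>2 \<le> (numerical_radius M)\<^sup>2"
      using p_up[OF that] m_up[OF that] by (auto intro: power_mono)
    then show "(?d x)\<^sup>2 \<le> ((numerical_radius P)\<^sup>2 + (numerical_radius M)\<^sup>2) / 2"
      using sum[of x] by argo
  qed
  then have "davis_wielandt_radius T \<le> sqrt (((numerical_radius P)\<^sup>2 + (numerical_radius M)\<^sup>2) / 2)"
    unfolding davis_wielandt_radius_def using ex by (intro cSup_least) auto
  from power_mono[OF this d0, of 2]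
  show "2 * (davis_wielandt_radius T)\<^sup>2 \<le> (numerical_radius P)\<^sup>2 + (numerical_radius M)\<^sup>2" by simp
qed

theorem theorem2p8:
  fixes T :: "'a::chilbert_space \<Rightarrow> 'a"
  assumes "bounded_clinear T"
  shows "1 / 2 * (SUP \<theta>::real.
             (numerical_radius (\<lambda>x. exp (\<i> * complex_of_real \<theta>) *\<^sub>C T x + cadjoint T (T x)))\<^sup>2
           + (crawford_number (\<lambda>x. exp (\<i> * complex_of_real \<theta>) *\<^sub>C T x - cadjoint T (T x)))\<^sup>2)
         \<le> (davis_wielandt_radius T)\<^sup>2
       \<and> (davis_wielandt_radius T)\<^sup>2
         \<le> 1 / 2 * ((numerical_radius (\<lambda>x. T x + cadjoint T (T x)))\<^sup>2
                  + (numerical_radius (\<lambda>x. T x - cadjoint T (T x)))\<^sup>2)"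
proof (cases "\<exists>x::'a. norm x = 1")
  case True
  \<comment> \<open>Not an axiom of the class, but the case \<open>r = 1\<close> of
    \<open>scaleC_of_real\<close>; it removes the scalar when \<open>u = 1\<close>.\<close>
  have "scaleC 1 x = x" for x :: 'a
    using scaleC_of_real[of 1 x] by simp
  then have "2 * (davis_wielandt_radius T)\<^sup>2
      \<le> (numerical_radius (\<lambda>x. T x + cadjoint T (T x)))\<^sup>2
        + (numerical_radius (\<lambda>x. T x - cadjoint T (T x)))\<^sup>2"
    using davis_wielandt_bounds(2)[OF assms True, of 1] by simp
  moreover have "(SUP \<theta>::real.
      (numerical_radius (\<lambda>x. exp (\<i> * complex_of_real \<theta>) *\<^sub>C T x + cadjoint T (T x)))\<^sup>2
    + (crawford_number (\<lambda>x. exp (\<i> * complex_of_real \<theta>) *\<^sub>C T x - cadjoint T (T x)))\<^sup>2)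
      \<le> 2 * (davis_wielandt_radius T)\<^sup>2"
    \<comment> \<open>The bound does not depend on the unimodular \<open>u\<close>, so it holds for
      every phase and passes to the supremum.\<close>
    by (intro cSUP_least davis_wielandt_bounds(1)[OF assms True]) auto
  ultimately show ?thesis by simp
next
  case False
  show ?thesis
    by (simp add: trivial_space_radii[OF False, of _ T])
qed

end
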